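(* Let $n\in\mathbb{N}$, let $A \subseteq \mathcal{N}^n$ be open, let $\boldsymbol{x_0}\in A$, and let $f : A \rightarrow \mathcal{N}$ be WLUD$^{\infty}$ at $\boldsymbol{x_0}$. For each $k\in\mathbb{N}$, let $\delta_k>0$ in $\mathcal{N}$ correspond to $\epsilon=1$ in the definition of WLUD$^k$ at $\boldsymbol{x_0}$; that is, $B_{\delta_k}(\boldsymbol{x_0})\subset\Omega_k$ for a neighborhood $\Omega_k$ of $\boldsymbol{x_0}$ in $A$ on which $f$ is $k$ times differentiable, and $$\left|f(\boldsymbol{\eta})-f(\boldsymbol{\xi})-\sum_{j=1}^{k} \frac{1}{j!}\left[(\boldsymbol{\eta}-\boldsymbol{\xi})\cdot\nabla\right]^{j}f(\boldsymbol{\xi})\right| \le |\boldsymbol{\eta} - \boldsymbol{\xi}|^k \quad\text{for all } \boldsymbol{\xi},\boldsymbol{\eta}\in B_{\delta_k}(\boldsymbol{x_0}).$$ Assume that $$\limsup_{\substack{j\rightarrow\infty\\ l_1=1,\ldots,n\\ \vdots\\ l_j=1,\ldots,n}}\left(\frac{-\lambda\left(\left.\frac{\partial^j f(\boldsymbol{x})}{\partial x_{l_{1}}\cdots\partial x_{l_{j}}}\right|_{\boldsymbol{x}=\boldsymbol{x_0}}\right)}{j}\right)<\infty \quad\text{ and }\quad \limsup_{k\rightarrow\infty}\lambda\left(\delta_k\right)<\infty,$$ where the first $\limsup$ is taken as $j\to\infty$ over all choices of indices $l_1,\ldots,l_j\in\{1,\ldots,n\}$ (i.e. it is the $\limsup$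 as $j\to\infty$ of the maximum of the displayed quantity over all such index tuples). Then there exists a neighborhood $U$ of $\boldsymbol{x_0}$ in $A$ such that, for any $\boldsymbol{\eta}\in U$, we have that $$f(\boldsymbol{\eta})=f(\boldsymbol{x_0})+\sum_{j=1}^{\infty} \frac{1}{j!}\left[(\boldsymbol{\eta}-\boldsymbol{x_0})\cdot\nabla\right]^{j}f(\boldsymbol{x_0}).$$
   Context: Throughout, $\mathcal{N}$ is a non-Archimedean ordered field extension of $\mathbb{R}$ that is real closed and Cauchy complete in the order topology, and whose Hahn group $S_{\mathcal{N}}$ is Archimedean, i.e. isomorphic to a subgroup of $(\mathbb{R},+,<)$. Here $|x|=\max\{x,-x\}$ is the ordinary absolute value on $\mathcal{N}$. The Hahn group $S_{\mathcal{N}}$ is the set of equivalence classes of nonzero elements of $\mathcal{N}$ under the relation $x\sim y$ iff there exist $n,m\in\mathbb{N}$ with $n|x|>|y|$ and $m|y|>|x|$. It carries the addition $[x]+[y]=[xy]$ and the order $[x]<[y]$ iff $|y|\ll|x|$, where $|y|\ll|x|$ means $n|y|<|x|$ for all $n\in\mathbb{N}$. We regard $S_{\mathcal{N}}$ as a subgroup of $\mathbb{R}$. Elements of $\mathcal{N}$ can be written as generalized power series (Hahn series) $x=\sum_{q\in S_{\mathcal{N}}}a_q d^q$ with $a_q\in\mathbb{R}$, $d$ a positive infinitely small element of $\mathcal{N}$, and $\mathrm{supp}(x)=\{q: a_q\neq 0\}$ a well-ordered subset of $S_{\mathcal{N}}$; one has $x>0$ iff $x\ne 0$ and the coefficient $a_{\min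 \mathrm{supp}(x)}$ is positive. For $x\neq0$, $\lambda(x)=\min(\mathrm{supp}(x))$, and $\lambda(0)=\infty$. Thus $\lambda$ is the natural (order) valuation of $\mathcal{N}$, taking values in $S_{\mathcal{N}}\cup\{\infty\}\subset\mathbb{R}\cup\{\infty\}$ ($\lambda(x)$ corresponds to the class $[x]$ for $x\ne 0$), and the valuation topology coincides with the order topology. All limits, derivatives, and sums of series in $\mathcal{N}$ are taken in the order topology. On $\mathcal{N}^n$, $|\boldsymbol{x}|=\sqrt{x_1^2+\cdots+x_n^2}\in\mathcal{N}$ denotes the Euclidean norm (square roots of nonnegative elements exist since $\mathcal{N}$ is real closed), and $B_\delta(\boldsymbol{x_0})=\{\boldsymbol{t}\in\mathcal{N}^n: |\boldsymbol{t}-\boldsymbol{x_0}|<\delta\}$ for $\delta>0$ in $\mathcal{N}$; $\mathcal{N}^n$ has the corresponding topology. Differentiability and $k$-times differentiability of functions on open subsets of $\mathcal{N}^n$ are understood in the usual sense, with respect to this norm. For $\boldsymbol{\xi},\boldsymbol{\eta}\in\mathcal{N}^n$ and $j\in\mathbb{N}$, $$\left[(\boldsymbol{\eta}-\boldsymbol{\xi})\cdot\nabla\right]^{j}f(\boldsymbol{\xi})=\sum_{l_{1},\ldots,l_{j}=1}^{n} \left(\left.\frac{\partial^j f(\boldsymbol{x})}{\partial x_{l_{1}}\cdots\partial x_{l_{j}}}\right|_{\boldsymbol{x}=\boldsymbol{\xi}}\prod_{m=1}^{j}\left(\eta_{l_{m}}-\xi_{l_{m}}\right)\right).$$ Let $A\subset\mathcal{N}^n$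 be open, $f:A\to\mathcal{N}$, $\boldsymbol{x_0}\in A$ and $k\in\mathbb{N}$. The function $f$ is WLUD$^k$ ($k$ times weakly locally uniformly differentiable) at $\boldsymbol{x_0}$ if $f$ is $k$ times differentiable in a neighborhood $\Omega$ of $\boldsymbol{x_0}$ in $A$ and if for every $\epsilon>0$ in $\mathcal{N}$ there exists $\delta>0$ in $\mathcal{N}$ such that $B_\delta(\boldsymbol{x_0})\subset\Omega$, and for all $\boldsymbol{\xi},\boldsymbol{\eta}\in B_\delta(\boldsymbol{x_0})$ we have $$\left|f(\boldsymbol{\eta})-f(\boldsymbol{\xi})-\sum_{j=1}^{k} \frac{1}{j!}\left[(\boldsymbol{\eta}-\boldsymbol{\xi})\cdot\nabla\right]^{j}f(\boldsymbol{\xi})\right| \le \epsilon |\boldsymbol{\eta} - \boldsymbol{\xi}|^k.$$ The function $f$ is WLUD$^\infty$ at $\boldsymbol{x_0}$ if $f$ is WLUD$^k$ at $\boldsymbol{x_0}$ for every $k\in\mathbb{N}$. *)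

theory Defs
  imports "HOL-Analysis.Analysis" "HOL-Computational_Algebra.Polynomial"
begin

section \<open>The Hahn group and the natural valuation\<close>

definition arch_equiv :: "('a::linordered_field \<times> 'a) set" where
  "arch_equiv = {(x, y). x \<noteq> 0 \<and> y \<noteq> 0 \<and>
     (\<exists>n m :: nat. of_nat n * \<bar>x\<bar> > \<bar>y\<bar> \<and> of_nat m * \<bar>y\<bar> > \<bar>x\<bar>)}"

definition much_less :: "'a::linordered_field \<Rightarrow> 'a \<Rightarrow> bool" where
  "much_less x y \<longleftrightarrow> (\<forall>n::nat. of_nat n * x < y)"

definition hahn_class :: "'a::linordered_field \<Rightarrow> 'a set" where
  "hahn_class x = arch_equiv `` {x}"

definition hahn_group :: "'a::linordered_field set set" where
  "hahn_group = (UNIV - {0}) // arch_equiv"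

definition hahn_add :: "'a::linordered_field set \<Rightarrow> 'a set \<Rightarrow> 'a set" where
  "hahn_add X Y = (\<Union>x\<in>X. \<Union>y\<in>Y. hahn_class (x * y))"

definition hahn_less :: "'a::linordered_field set \<Rightarrow> 'a set \<Rightarrow> bool" where
  "hahn_less X Y \<longleftrightarrow> (\<exists>x\<in>X. \<exists>y\<in>Y. much_less \<bar>y\<bar> \<bar>x\<bar>)"

lemma equiv_arch_equiv: "equiv (UNIV - {0 :: 'a::linordered_field}) arch_equiv"
proof (rule equivI)
  show "arch_equiv \<subseteq> (UNIV - {0 :: 'a}) \<times> (UNIV - {0})"
    by (auto simp: arch_equiv_def)
  show "refl_on (UNIV - {0 :: 'a}) arch_equiv"
  proof (rule refl_onI)
    fix x :: 'a assume "x \<in> UNIV - {0}"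
    then have "of_nat 2 * \<bar>x\<bar> > \<bar>x\<bar>" by simp
    then show "(x, x) \<in> arch_equiv"
      using \<open>x \<in> UNIV - {0}\<close> unfolding arch_equiv_def by blast
  qed
  show "sym (arch_equiv :: ('a \<times> 'a) set)"
    by (auto simp: arch_equiv_def sym_def)
  have step: "\<exists>n::nat. of_nat n * \<bar>x\<bar> > \<bar>z\<bar>"
    if "of_nat n * \<bar>x\<bar> > \<bar>y\<bar>" "of_nat m * \<bar>y\<bar> > \<bar>z\<bar>" for x y z :: 'a and n m :: nat
  proof -
    have "\<bar>z\<bar> < of_nat m * \<bar>y\<bar>" by fact
    also have "\<dots> \<le> of_nat m * (of_nat n * \<bar>x\<bar>)"
      using that(1) by (intro mult_left_mono) auto
    also have "\<dots> = of_nat (m * n) * \<bar>x\<bar>" by (simp add: mult.assoc)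
    finally show ?thesis by blast
  qed
  show "trans (arch_equiv :: ('a \<times> 'a) set)"
    using step by (fastforce simp: arch_equiv_def trans_def)
qed

lemma hahn_class_eq_iff:
  fixes x y :: "'a::linordered_field"
  assumes "x \<noteq> 0" "y \<noteq> 0"
  shows "hahn_class x = hahn_class y \<longleftrightarrow> (x, y) \<in> arch_equiv"
  unfolding hahn_class_def
  using assms eq_equiv_class_iff[OF equiv_arch_equiv, of x y] by simp

lemma hahn_add_class:
  fixes x y :: "'a::linordered_field"
  assumes "x \<noteq> 0" "y \<noteq> 0"
  shows "hahn_add (hahn_class x) (hahn_class y) = hahn_class (x * y)"
proof -
  have *: "hahn_class (u * v) = hahn_class (x * y)"
    if uv: "u \<in> hahn_class x" "v \<in> hahn_class y" for u v
  proof -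
    have step: "\<exists>n::nat. of_nat n * \<bar>a * b\<bar> > \<bar>c * d\<bar>"
      if "of_nat n * \<bar>a\<bar> > \<bar>c\<bar>" "of_nat m * \<bar>b\<bar> > \<bar>d\<bar>" for a b c d :: 'a and n m :: nat
    proof -
      have "\<bar>c\<bar> * \<bar>d\<bar> < (of_nat n * \<bar>a\<bar>) * (of_nat m * \<bar>b\<bar>)"
        using that by (intro mult_strict_mono') auto
      then have "\<bar>c * d\<bar> < of_nat (n * m) * \<bar>a * b\<bar>"
        by (simp add: abs_mult mult_ac)
      then show ?thesis by blast
    qed
    have "(x * y, u * v) \<in> arch_equiv" "u * v \<noteq> 0"
      using uv step by (auto simp: hahn_class_def arch_equiv_def)
    then show ?thesis using hahn_class_eq_iff[of "x * y" "u * v"] assms by auto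
  qed
  have "x \<in> hahn_class x" "y \<in> hahn_class y"
    using equiv_class_self[OF equiv_arch_equiv] assms by (auto simp: hahn_class_def)
  then show ?thesis unfolding hahn_add_def using * by blast
qed

lemma hahn_less_class:
  fixes x y :: "'a::linordered_field"
  assumes "x \<noteq> 0" "y \<noteq> 0"
  shows "hahn_less (hahn_class x) (hahn_class y) \<longleftrightarrow> much_less \<bar>y\<bar> \<bar>x\<bar>"
proof
  assume "much_less \<bar>y\<bar> \<bar>x\<bar>"
  moreover have "x \<in> hahn_class x" "y \<in> hahn_class y"
    using equiv_class_self[OF equiv_arch_equiv] assms by (auto simp: hahn_class_def)
  ultimately show "hahn_less (hahn_class x) (hahn_class y)"
    unfolding hahn_less_def by blast
next
  assume "hahn_less (hahn_class x) (hahn_class y)"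
  then obtain u v n m where uv: "much_less \<bar>v\<bar> \<bar>u\<bar>"
    and n: "of_nat n * \<bar>x\<bar> > \<bar>u\<bar>" and m: "of_nat m * \<bar>v\<bar> > \<bar>y\<bar>"
    by (auto simp: hahn_less_def hahn_class_def arch_equiv_def)
  show "much_less \<bar>y\<bar> \<bar>x\<bar>"
    unfolding much_less_def
  proof
    fix k :: nat
    have npos: "(of_nat n :: 'a) > 0"
      using n by (cases "n = 0") auto
    have "of_nat n * (of_nat k * \<bar>y\<bar>) \<le> of_nat n * (of_nat k * (of_nat m * \<bar>v\<bar>))"
      using m by (intro mult_left_mono) auto
    also have "\<dots> = of_nat (n * k * m) * \<bar>v\<bar>" by (simp add: mult_ac)
    also have "\<dots> < \<bar>u\<bar>" using uv unfolding much_less_def by blast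
    also have "\<dots> < of_nat n * \<bar>x\<bar>" by fact
    finally show "of_nat k * \<bar>y\<bar> < \<bar>x\<bar>"
      using npos mult_less_cancel_left_pos by blast
  qed
qed

text \<open>The map \<open>\<phi>\<close> is the identification of the Hahn group with a subgroup of the reals.\<close>

definition hahn_val :: "('a::linordered_field set \<Rightarrow> real) \<Rightarrow> 'a \<Rightarrow> ereal" where
  "hahn_val \<phi> x = (if x = 0 then \<infinity> else ereal (\<phi> (hahn_class x)))"


section \<open>The base field\<close>

text \<open>
  The topology of the type is its order topology. The map \<open>\<iota>\<close> is the embedding of the reals.
  The conditions on \<open>\<phi>\<close> make it injective, since \<^const>\<open>hahn_less\<close> is total on
  \<^const>\<open>hahn_group\<close>. Completeness is stated for sequences: \<open>\<phi>\<close> forces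
  the order topology to be first countable, so this is the same as completeness for nets.
\<close>

locale nonarch_field =
  fixes \<iota> :: "real \<Rightarrow> 'a::{linordered_field, linorder_topology}"
    and \<phi> :: "'a set \<Rightarrow> real"
  assumes emb_one: "\<iota> 1 = 1"
    and emb_add: "\<iota> (r + s) = \<iota> r + \<iota> s"
    and emb_mult: "\<iota> (r * s) = \<iota> r * \<iota> s"
    and emb_less: "r < s \<Longrightarrow> \<iota> r < \<iota> s"
    and nonarchimedean: "\<exists>x::'a. \<forall>n::nat. of_nat n < x"
    and real_closed_sqrt: "0 \<le> (x::'a) \<Longrightarrow> \<exists>y. y\<^sup>2 = x"
    and real_closed_odd: "odd (degree (p :: 'a poly)) \<Longrightarrow> \<exists>x. poly p x = 0"
    and cauchy_complete:
      "(\<And>e. 0 < e \<Longrightarrow> \<exists>N. \<forall>m\<ge>N. \<forall>n\<ge>N. \<bar>(X :: nat \<Rightarrow> 'a) m - X n\<bar> < e) \<Longrightarrow> convergent X"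
    and hahn_hom: "\<lbrakk>S \<in> hahn_group; T \<in> hahn_group\<rbrakk> \<Longrightarrow> \<phi> (hahn_add S T) = \<phi> S + \<phi> T"
    and hahn_mono: "\<lbrakk>S \<in> hahn_group; T \<in> hahn_group\<rbrakk> \<Longrightarrow> hahn_less S T \<longleftrightarrow> \<phi> S < \<phi> T"


section \<open>Euclidean norm and topology on the coordinate space\<close>

definition field_sqrt :: "'a::linordered_field \<Rightarrow> 'a" where
  "field_sqrt x = (THE y. 0 \<le> y \<and> y\<^sup>2 = x)"

definition vnorm :: "'a::linordered_field ^ 'n \<Rightarrow> 'a" where
  "vnorm x = field_sqrt (\<Sum>i\<in>UNIV. (x $ i)\<^sup>2)"

definition vball :: "'a::linordered_field ^ 'n \<Rightarrow> 'a \<Rightarrow> ('a ^ 'n) set" where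
  "vball x d = {t. vnorm (t - x) < d}"

definition vopen :: "('a::linordered_field ^ 'n) set \<Rightarrow> bool" where
  "vopen S \<longleftrightarrow> (\<forall>x\<in>S. \<exists>d>0. vball x d \<subseteq> S)"


section \<open>Derivatives\<close>

text \<open>
  Functions on an open set are represented by total functions. Differentiability and partial
  derivatives at a point only depend on the values near that point, so
  the values outside the open set play no role.
\<close>

definition vdifferentiable_at :: "('a::linordered_field ^ 'n \<Rightarrow> 'a) \<Rightarrow> 'a ^ 'n \<Rightarrow> bool" where
  "vdifferentiable_at f x \<longleftrightarrow>
     (\<exists>L. Vector_Spaces.linear vector_scalar_mult times L \<and>
       (\<forall>e>0. \<exists>d>0. \<forall>y\<in>vball x d. \<bar>f y - f x - L (y - x)\<bar> \<le> e * vnorm (y - x)))"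

definition partial ::
    "'n \<Rightarrow> ('a::{linordered_field, linorder_topology} ^ 'n \<Rightarrow> 'a) \<Rightarrow> 'a ^ 'n \<Rightarrow> 'a" where
  "partial l f x = Lim (at 0) (\<lambda>h. (f (x + h *s axis l 1) - f x) / h)"

lemma eventually_at_zero_field:
  "eventually P (at (0::'a::{linordered_field, linorder_topology})) \<longleftrightarrow>
     (\<exists>d>0. \<forall>h. h \<noteq> 0 \<longrightarrow> \<bar>h\<bar> < d \<longrightarrow> P h)"
proof
  assume "eventually P (at (0::'a))"
  then obtain S where S: "open S" "0 \<in> S" "\<And>h. h \<in> S \<Longrightarrow> h \<noteq> 0 \<Longrightarrow> P h"
    by (auto simp: eventually_at_topological)
  obtain b where b: "b > 0" "{0..<b} \<subseteq> S"
    using open_right[OF S(1,2), of 1] by auto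
  obtain a where a: "a < 0" "{a<..0} \<subseteq> S"
    using open_left[OF S(1,2), of "-1"] by auto
  show "\<exists>d>0. \<forall>h. h \<noteq> 0 \<longrightarrow> \<bar>h\<bar> < d \<longrightarrow> P h"
  proof (intro exI conjI allI impI)
    show "min b (- a) > 0" using a b by simp
    fix h :: 'a assume h: "h \<noteq> 0" "\<bar>h\<bar> < min b (- a)"
    have "h \<in> {0..<b} \<or> h \<in> {a<..0}" using h by auto
    then show "P h" using S(3) h(1) a b by blast
  qed
next
  assume "\<exists>d>0. \<forall>h. h \<noteq> 0 \<longrightarrow> \<bar>h\<bar> < d \<longrightarrow> P h"
  then obtain d where d: "d > 0" "\<And>h. h \<noteq> 0 \<Longrightarrow> \<bar>h\<bar> < d \<Longrightarrow> P h" by blast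
  have "open {-d<..<d}" "0 \<in> {-d<..<d}" using d by auto
  moreover have "P h" if "h \<in> {-d<..<d}" "h \<noteq> 0" for h
    using that d(2)[of h] by (simp add: abs_less_iff)
  ultimately show "eventually P (at (0::'a))"
    unfolding eventually_at_topological by blast
qed

lemma vnorm_axis: "vnorm (h *s axis l (1::'a::linordered_field)) = \<bar>h\<bar>"
proof -
  have "(\<Sum>i\<in>UNIV. ((h *s axis l (1::'a)) $ i)\<^sup>2) = (\<Sum>i\<in>UNIV. if i = l then h\<^sup>2 else 0)"
    by (intro sum.cong) (auto simp: axis_def)
  also have "\<dots> = h\<^sup>2" by simp
  finally have eq: "(\<Sum>i\<in>UNIV. ((h *s axis l (1::'a)) $ i)\<^sup>2) = h\<^sup>2" .
  have "(THE y. 0 \<le> y \<and> y\<^sup>2 = h\<^sup>2) = \<bar>h\<bar>"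
    by (rule the_equality) (auto simp: power2_eq_iff)
  then show ?thesis unfolding vnorm_def field_sqrt_def eq .
qed

text \<open>
  The coordinates of the derivative of a differentiable function are its partial derivatives.
  Hence the derivative is \<open>k\<close> times differentiable iff all partial derivatives are, which is the
  recursion used for \<open>times_differentiable_on\<close>.
\<close>

lemma derivative_axis_eq_partial:
  fixes f :: "'a::{linordered_field, linorder_topology} ^ 'n \<Rightarrow> 'a"
  assumes L: "Vector_Spaces.linear vector_scalar_mult times L"
    and est: "\<And>e. e > 0 \<Longrightarrow>
      \<exists>d>0. \<forall>y\<in>vball x d. \<bar>f y - f x - L (y - x)\<bar> \<le> e * vnorm (y - x)"
  shows "L (axis l 1) = partial l f x"
proof -
  let ?q = "\<lambda>h. (f (x + h *s axis l 1) - f x) / h"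
  have close: "eventually (\<lambda>h. \<bar>?q h - L (axis l 1)\<bar> \<le> e) (at 0)" if e: "e > 0" for e
  proof -
    obtain d where d: "d > 0"
      "\<And>y. y \<in> vball x d \<Longrightarrow> \<bar>f y - f x - L (y - x)\<bar> \<le> e * vnorm (y - x)"
      using est[OF e] by blast
    have "\<bar>?q h - L (axis l 1)\<bar> \<le> e" if h: "h \<noteq> 0" "\<bar>h\<bar> < d" for h
    proof -
      let ?y = "x + h *s axis l 1"
      have "?y \<in> vball x d" using h by (simp add: vball_def vnorm_axis)
      from d(2)[OF this] have "\<bar>f ?y - f x - h * L (axis l 1)\<bar> \<le> e * \<bar>h\<bar>"
        using module_hom.scale[OF L[folded module_hom_iff_linear]] by (simp add: vnorm_axis)
      moreover have "?q h - L (axis l 1) = (f ?y - f x - h * L (axis l 1)) / h"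
        using h by (simp add: field_simps)
      ultimately show ?thesis using h by (simp add: abs_divide pos_divide_le_eq)
    qed
    then show ?thesis unfolding eventually_at_zero_field using d(1) by blast
  qed
  have "(?q \<longlongrightarrow> L (axis l 1)) (at 0)"
  proof (rule order_tendstoI)
    fix a assume "a < L (axis l 1)"
    then obtain c where c: "a < c" "c < L (axis l 1)" using dense by blast
    define e where "e = L (axis l 1) - c"
    have e: "e > 0" "a < L (axis l 1) - e" using c by (simp_all add: e_def)
    from close[OF e(1)] show "eventually (\<lambda>h. a < ?q h) (at 0)"
    proof eventually_elim
      case (elim h)
      then have "L (axis l 1) - ?q h \<le> e" using abs_le_D2[of "?q h - L (axis l 1)" e] by simp
      then show ?case using e(2) by linarith
    qed
  next
    fix a assume "L (axis l 1) < a"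
    then obtain c where c: "L (axis l 1) < c" "c < a" using dense by blast
    define e where "e = c - L (axis l 1)"
    have e: "e > 0" "L (axis l 1) + e < a" using c by (simp_all add: e_def)
    from close[OF e(1)] show "eventually (\<lambda>h. ?q h < a) (at 0)"
    proof eventually_elim
      case (elim h)
      then have "?q h - L (axis l 1) \<le> e" by (rule abs_le_D1)
      then show ?case using e(2) by linarith
    qed
  qed
  moreover have "at (0::'a) \<noteq> bot"
  proof
    assume "at (0::'a) = bot"
    then have "eventually (\<lambda>_. False) (at (0::'a))" by simp
    then obtain d :: 'a where "d > 0" "\<And>h. h \<noteq> 0 \<Longrightarrow> \<not> \<bar>h\<bar> < d"
      unfolding eventually_at_zero_field by blast
    from this(2)[of "d / 2"] this(1) show False by simp
  qed
  ultimately show ?thesis unfolding partial_def using tendsto_Lim[of "at 0" ?q] by simp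
qed

fun times_differentiable_on ::
    "nat \<Rightarrow> ('a::{linordered_field, linorder_topology} ^ 'n \<Rightarrow> 'a) \<Rightarrow> ('a ^ 'n) set \<Rightarrow> bool" where
  "times_differentiable_on 0 f S \<longleftrightarrow> True"
| "times_differentiable_on (Suc k) f S \<longleftrightarrow>
     (\<forall>x\<in>S. vdifferentiable_at f x) \<and> (\<forall>l. times_differentiable_on k (partial l f) S)"

text \<open>The list \<open>[l\<^sub>1, \<dots>, l\<^sub>j]\<close> stands for differentiation by \<open>x\<^sub>l\<^sub>1, \<dots>, x\<^sub>l\<^sub>j\<close>, the last one first.\<close>

definition partials ::
    "'n list \<Rightarrow> ('a::{linordered_field, linorder_topology} ^ 'n \<Rightarrow> 'a) \<Rightarrow> 'a ^ 'n \<Rightarrow> 'a" where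
  "partials ls f = foldr partial ls f"

definition dir_deriv ::
    "nat \<Rightarrow> ('a::{linordered_field, linorder_topology} ^ 'n \<Rightarrow> 'a) \<Rightarrow> 'a ^ 'n \<Rightarrow> 'a ^ 'n \<Rightarrow> 'a" where
  "dir_deriv j f \<xi> \<eta> =
     (\<Sum>ls | length ls = j. partials ls f \<xi> * (\<Prod>m<j. \<eta> $ (ls ! m) - \<xi> $ (ls ! m)))"


section \<open>Weak local uniform differentiability\<close>

text \<open>The radius \<open>\<delta>\<close> corresponds to \<open>\<epsilon>\<close> in the definition of WLUD of order \<open>k\<close>.\<close>

definition WLUD_radius ::
    "nat \<Rightarrow> ('a::{linordered_field, linorder_topology} ^ 'n \<Rightarrow> 'a) \<Rightarrow> 'a ^ 'n \<Rightarrow>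
     ('a ^ 'n) set \<Rightarrow> 'a \<Rightarrow> 'a \<Rightarrow> bool" where
  "WLUD_radius k f x0 \<Omega> \<epsilon> \<delta> \<longleftrightarrow> \<delta> > 0 \<and> vball x0 \<delta> \<subseteq> \<Omega> \<and>
     (\<forall>\<xi>\<in>vball x0 \<delta>. \<forall>\<eta>\<in>vball x0 \<delta>.
        \<bar>f \<eta> - f \<xi> - (\<Sum>j=1..k. 1 / fact j * dir_deriv j f \<xi> \<eta>)\<bar> \<le> \<epsilon> * vnorm (\<eta> - \<xi>) ^ k)"

definition WLUD_nbhd ::
    "nat \<Rightarrow> ('a::{linordered_field, linorder_topology} ^ 'n) set \<Rightarrow> ('a ^ 'n \<Rightarrow> 'a) \<Rightarrow> 'a ^ 'n \<Rightarrow>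
     ('a ^ 'n) set \<Rightarrow> bool" where
  "WLUD_nbhd k A f x0 \<Omega> \<longleftrightarrow>
     vopen \<Omega> \<and> x0 \<in> \<Omega> \<and> \<Omega> \<subseteq> A \<and> times_differentiable_on k f \<Omega>"

definition WLUD ::
    "nat \<Rightarrow> ('a::{linordered_field, linorder_topology} ^ 'n) set \<Rightarrow> ('a ^ 'n \<Rightarrow> 'a) \<Rightarrow> 'a ^ 'n \<Rightarrow>
     bool" where
  "WLUD k A f x0 \<longleftrightarrow>
     (\<exists>\<Omega>. WLUD_nbhd k A f x0 \<Omega> \<and> (\<forall>\<epsilon>>0. \<exists>\<delta>. WLUD_radius k f x0 \<Omega> \<epsilon> \<delta>))"

definition WLUD_infinity ::
    "('a::{linordered_field, linorder_topology} ^ 'n) set \<Rightarrow> ('a ^ 'n \<Rightarrow> 'a) \<Rightarrow> 'a ^ 'n \<Rightarrow> bool" where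
  "WLUD_infinity A f x0 \<longleftrightarrow> (\<forall>k\<ge>1. WLUD k A f x0)"

end

theory Submission
  imports Defs
begin

text \<open>
  With \<open>\<epsilon> = 1\<close> and \<open>\<xi> = x\<^sub>0\<close>, the \<open>WLUD\<close> estimate of order \<open>k\<close> is a Taylor formula at \<open>x\<^sub>0\<close>: on the
  ball of radius \<open>\<delta> k\<close>, the difference between \<open>f \<eta>\<close> and its \<open>k\<close>-th Taylor polynomial is at most
  \<open>r ^ k\<close>, where \<open>r\<close> is the norm of \<open>\<eta> - x\<^sub>0\<close>. The series thus represents \<open>f \<eta>\<close> as soon as \<open>\<eta>\<close> lies
  in the balls of all large orders \<open>k\<close> and the powers \<open>r ^ k\<close> tend to zero.

  Both follow from properties of the valuation. A bound \<open>C\<close> for the valuations of the radii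
  \<open>\<delta> k\<close> of large order makes every positive \<open>\<sigma>\<close> of valuation larger than \<open>C\<close> smaller than all these radii, so the
  balls do not shrink to a point (\<open>radii_bounded_below\<close>). Infinitesimals of arbitrarily large
  valuation exist because the valuations of the powers of one infinitesimal are the multiples of
  a positive real number (\<open>ex_infinitesimal_lam_greater\<close>). For the same reason the powers of an
  infinitesimal tend to zero (\<open>power_eventually_less\<close>), which is where the Archimedean property of
  the Hahn group enters.

  The neighbourhood is a cube inside the ball of radius \<open>\<sigma>\<close>. Openness of a cube in the
  Euclidean norm comes down to the bound of a coordinate by the norm, and so avoids the triangle
  inequality for this norm.
\<close>

section \<open>The natural valuation as a real-valued function\<close>

context nonarch_field
begin

definition lam :: "'a \<Rightarrow> real" where
  "lam x = \<phi> (hahn_class x)"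

lemma hahn_class_in_hahn_group:
  fixes x :: 'a
  assumes "x \<noteq> 0"
  shows "hahn_class x \<in> hahn_group"
  using assms by (auto simp: hahn_class_def hahn_group_def intro: quotientI)

lemma lam_mult:
  assumes "x \<noteq> 0" "y \<noteq> 0"
  shows "lam (x * y) = lam x + lam y"
  using assms hahn_hom[of "hahn_class x" "hahn_class y"]
  by (simp add: lam_def hahn_add_class hahn_class_in_hahn_group)

lemma lam_one: "lam 1 = 0"
  using lam_mult[of 1 1] by simp

lemma lam_power: "x \<noteq> 0 \<Longrightarrow> lam (x ^ k) = real k * lam x"
  by (induction k) (auto simp: lam_one lam_mult algebra_simps)

lemma lam_less_iff:
  assumes "x \<noteq> 0" "y \<noteq> 0"
  shows "lam x < lam y \<longleftrightarrow> much_less \<bar>y\<bar> \<bar>x\<bar>"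
  using assms hahn_mono[of "hahn_class x" "hahn_class y"]
  by (simp add: lam_def hahn_less_class hahn_class_in_hahn_group)

lemma less_if_lam_less:
  assumes "lam x < lam y" "0 < x" "0 < y"
  shows "y < x"
proof -
  have "much_less y x" using assms lam_less_iff[of x y] by simp
  then have "of_nat 1 * y < x" unfolding much_less_def by blast
  then show ?thesis by simp
qed

section \<open>Infinitesimals and their powers\<close>

lemma ex_infinitesimal:
  obtains d :: 'a where "0 < d" "\<And>n. of_nat n * d < 1" "0 < lam d"
proof -
  obtain w :: 'a where w: "\<And>n. of_nat n < w" using nonarchimedean by blast
  have "0 < w" using w[of 0] by simp
  define d where "d = 1 / w"
  have d: "0 < d" "\<And>n. of_nat n * d < 1"
    using \<open>0 < w\<close> w by (simp_all add: d_def divide_less_eq)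
  then have "much_less \<bar>d\<bar> \<bar>1\<bar>" by (simp add: much_less_def)
  then have "lam 1 < lam d" using d(1) by (simp add: lam_less_iff)
  then show thesis using that d by (simp add: lam_one)
qed

lemma ex_infinitesimal_lam_greater:
  obtains s :: 'a where "0 < s" "C < lam s"
proof -
  obtain d :: 'a where d: "0 < d" "0 < lam d" using ex_infinitesimal by blast
  obtain m where "C < real m * lam d" using d(2) reals_Archimedean3 by blast
  then show thesis using that[of "d ^ m"] d by (simp add: lam_power)
qed

lemma power_eventually_less:
  assumes s: "0 < s" "0 < lam s" and e: "0 < e"
  shows "\<forall>\<^sub>F k in sequentially. s ^ k < e"
proof -
  obtain K where K: "lam e < real K * lam s" using s(2) reals_Archimedean3 by blast
  have "s ^ k < e" if "K \<le> k" for k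
  proof (rule less_if_lam_less)
    have "real K * lam s \<le> real k * lam s" using that s(2) by simp
    then show "lam e < lam (s ^ k)" using K s(1) by (simp add: lam_power)
  qed (use s e in auto)
  then show ?thesis unfolding eventually_sequentially by blast
qed

text \<open>
  An upper bound on valuations is a lower bound on sizes; \<open>\<sigma>\<close> is moreover chosen infinitesimal so
  that its powers tend to zero.
\<close>

lemma radii_bounded_below:
  fixes \<delta> :: "nat \<Rightarrow> 'a"
  assumes pos: "\<And>k. 1 \<le> k \<Longrightarrow> 0 < \<delta> k"
    and lim: "limsup (\<lambda>k. hahn_val \<phi> (\<delta> k)) < \<infinity>"
  obtains \<sigma> where "0 < \<sigma>" "0 < lam \<sigma>" "\<forall>\<^sub>F k in sequentially. \<sigma> < \<delta> k"
proof -
  obtain C :: real where "limsup (\<lambda>k. hahn_val \<phi> (\<delta> k)) < ereal C"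
    using ereal_dense2[OF lim] by blast
  then have ev: "\<forall>\<^sub>F k in sequentially. hahn_val \<phi> (\<delta> k) < ereal C"
    by (rule Limsup_lessD)
  obtain \<sigma> where \<sigma>: "0 < \<sigma>" "max C 0 < lam \<sigma>" using ex_infinitesimal_lam_greater by blast
  have "\<forall>\<^sub>F k in sequentially. \<sigma> < \<delta> k"
    using ev eventually_ge_at_top[of 1]
  proof eventually_elim
    case (elim k)
    have "0 < \<delta> k" using elim pos by simp
    then have "lam (\<delta> k) < C" using elim by (simp add: hahn_val_def lam_def)
    then have "lam (\<delta> k) < lam \<sigma>" using \<sigma>(2) by linarith
    then show ?case using \<sigma>(1) \<open>0 < \<delta> k\<close> by (simp add: less_if_lam_less)
  qed
  then show thesis using that \<sigma> by simp
qed

section \<open>The Euclidean norm and cubes\<close>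

lemma field_sqrt:
  fixes x :: 'a
  assumes "0 \<le> x"
  shows "0 \<le> field_sqrt x \<and> (field_sqrt x)\<^sup>2 = x"
proof -
  obtain y where y: "y\<^sup>2 = x" using real_closed_sqrt assms by blast
  show ?thesis
    unfolding field_sqrt_def
  proof (rule theI[where a = "\<bar>y\<bar>"])
    fix z :: 'a assume "0 \<le> z \<and> z\<^sup>2 = x"
    then show "z = \<bar>y\<bar>" using y by (auto simp: power2_eq_iff)
  qed (simp add: y)
qed

lemma vnorm_nonneg: "0 \<le> vnorm (v :: 'a ^ 'n)"
  and vnorm_power2: "(vnorm (v :: 'a ^ 'n))\<^sup>2 = (\<Sum>i\<in>UNIV. (v $ i)\<^sup>2)"
  using field_sqrt[of "\<Sum>i\<in>UNIV. (v $ i)\<^sup>2"] by (simp_all add: vnorm_def sum_nonneg)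

lemma component_le_vnorm: "\<bar>(v :: 'a ^ 'n) $ i\<bar> \<le> vnorm v"
proof (rule power2_le_imp_le)
  have "(v $ i)\<^sup>2 \<le> (\<Sum>i\<in>UNIV. (v $ i)\<^sup>2)" by (rule member_le_sum) auto
  then show "\<bar>v $ i\<bar>\<^sup>2 \<le> (vnorm v)\<^sup>2" by (simp add: vnorm_power2)
qed (rule vnorm_nonneg)

text \<open>
  The factor \<open>CARD('n)\<close> is not sharp, but here factors that are natural numbers are absorbed by an
  infinitesimal.
\<close>

lemma vnorm_le_of_components:
  fixes v :: "'a ^ 'n"
  assumes "\<And>i. \<bar>v $ i\<bar> \<le> c"
  shows "vnorm v \<le> of_nat CARD('n) * c"
proof (rule power2_le_imp_le)
  have c: "0 \<le> c" using assms abs_ge_zero order_trans by blast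
  have "(v $ i)\<^sup>2 \<le> c\<^sup>2" for i using power_mono[OF assms[of i], of 2] by simp
  then have "(vnorm v)\<^sup>2 \<le> of_nat CARD('n) * c\<^sup>2"
    unfolding vnorm_power2 by (intro sum_bounded_above) auto
  also have "\<dots> \<le> (of_nat CARD('n))\<^sup>2 * c\<^sup>2"
    by (intro mult_right_mono) (auto simp: power2_eq_square Suc_le_eq simp flip: of_nat_mult)
  finally show "(vnorm v)\<^sup>2 \<le> (of_nat CARD('n) * c)\<^sup>2" by (simp add: power_mult_distrib)
  show "0 \<le> of_nat CARD('n) * c" using c by simp
qed

lemma vopen_cube: "vopen {t :: 'a ^ 'n. \<forall>i. \<bar>t $ i - x $ i\<bar> < \<rho>}"
  unfolding vopen_def
proof (intro ballI exI conjI)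
  fix t :: "'a ^ 'n" assume t: "t \<in> {t. \<forall>i. \<bar>t $ i - x $ i\<bar> < \<rho>}"
  define d where "d = (MIN i. \<rho> - \<bar>t $ i - x $ i\<bar>)"
  show "0 < d" using t by (auto simp: d_def)
  show "vball t d \<subseteq> {t. \<forall>i. \<bar>t $ i - x $ i\<bar> < \<rho>}"
  proof (intro subsetI CollectI allI)
    fix u i assume u: "u \<in> vball t d"
    have "\<bar>u $ i - t $ i\<bar> < d"
      using component_le_vnorm[of "u - t" i] u by (simp add: vball_def)
    also have "d \<le> \<rho> - \<bar>t $ i - x $ i\<bar>" by (simp add: d_def)
    finally show "\<bar>u $ i - x $ i\<bar> < \<rho>"
      using abs_triangle_ineq[of "u $ i - t $ i" "t $ i - x $ i"] by simp
  qed
qed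

lemma ex_cube_subset_vball:
  fixes x :: "'a ^ 'n"
  assumes "0 < \<sigma>"
  obtains U where "vopen U" "x \<in> U" "U \<subseteq> vball x \<sigma>"
proof -
  obtain d :: 'a where d: "0 < d" "\<And>n. of_nat n * d < 1" using ex_infinitesimal by blast
  define U where "U = {t. \<forall>i. \<bar>t $ i - x $ i\<bar> < d * \<sigma>}"
  have "vnorm (t - x) < \<sigma>" if "t \<in> U" for t
  proof -
    have "vnorm (t - x) \<le> of_nat CARD('n) * (d * \<sigma>)"
      using that by (intro vnorm_le_of_components) (auto simp: U_def intro: less_imp_le)
    also have "\<dots> = (of_nat CARD('n) * d) * \<sigma>" by (simp add: mult.assoc)
    also have "\<dots> < 1 * \<sigma>" using d(2) assms by (intro mult_strict_right_mono)
    finally show ?thesis by simp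
  qed
  then have "U \<subseteq> vball x \<sigma>" by (auto simp: vball_def)
  moreover have "x \<in> U" using d(1) assms by (simp add: U_def)
  moreover have "vopen U" unfolding U_def by (rule vopen_cube)
  ultimately show thesis using that by blast
qed

end

section \<open>Convergence of the Taylor series\<close>

text \<open>
  The squeeze is carried out with the order, since the type has no metric and its operations
  carry no continuity class.
\<close>

lemma LIMSEQ_if_abs_diff_eventually_less:
  fixes X :: "nat \<Rightarrow> 'a::{linordered_field, linorder_topology}"
  assumes "\<And>e. 0 < e \<Longrightarrow> \<forall>\<^sub>F k in sequentially. \<bar>L - X k\<bar> < e"
  shows "X \<longlonglongrightarrow> L"
proof (rule order_tendstoI)
  fix a assume "a < L"
  then have "\<forall>\<^sub>F k in sequentially. \<bar>L - X k\<bar> < L - a" by (intro assms) simp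
  then show "\<forall>\<^sub>F k in sequentially. a < X k" by eventually_elim (auto simp: abs_less_iff)
next
  fix a assume "L < a"
  then have "\<forall>\<^sub>F k in sequentially. \<bar>L - X k\<bar> < a - L" by (intro assms) simp
  then show "\<forall>\<^sub>F k in sequentially. X k < a" by eventually_elim (auto simp: abs_less_iff)
qed

text \<open>
  The Taylor remainder of order \<open>k\<close> at \<open>x\<^sub>0\<close> is at most \<open>\<sigma> ^ k\<close>, and these powers tend to zero since
  \<open>\<sigma>\<close> is infinitesimal.
\<close>

lemma (in nonarch_field) taylor_series_sums:
  fixes f :: "'a ^ 'n \<Rightarrow> 'a"
  assumes rad: "\<And>k. 1 \<le> k \<Longrightarrow> \<exists>\<Omega>. WLUD_radius k f x0 \<Omega> 1 (\<delta> k)"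
    and \<sigma>: "0 < \<sigma>" "0 < lam \<sigma>" "\<forall>\<^sub>F k in sequentially. \<sigma> < \<delta> k"
    and \<eta>: "\<eta> \<in> vball x0 \<sigma>"
  shows "(\<lambda>j. 1 / fact (Suc j) * dir_deriv (Suc j) f x0 \<eta>) sums (f \<eta> - f x0)"
  unfolding sums_def
proof (rule LIMSEQ_if_abs_diff_eventually_less)
  fix e :: 'a assume "0 < e"
  have x0: "vnorm (x0 - x0) = 0"
    using vnorm_power2[of "x0 - x0"] by simp
  have r: "vnorm (\<eta> - x0) < \<sigma>" using \<eta> by (simp add: vball_def)
  from power_eventually_less[OF \<sigma>(1,2) \<open>0 < e\<close>] \<sigma>(3) eventually_ge_at_top[of 1]
  show "\<forall>\<^sub>F k in sequentially.
      \<bar>f \<eta> - f x0 - (\<Sum>j<k. 1 / fact (Suc j) * dir_deriv (Suc j) f x0 \<eta>)\<bar> < e"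
  proof eventually_elim
    case (elim k)
    obtain \<Omega> where \<Omega>: "WLUD_radius k f x0 \<Omega> 1 (\<delta> k)" using rad elim(3) by blast
    have "x0 \<in> vball x0 (\<delta> k)" "\<eta> \<in> vball x0 (\<delta> k)"
      using x0 r elim(2) \<sigma>(1) unfolding vball_def by auto
    then have "\<bar>f \<eta> - f x0 - (\<Sum>j=1..k. 1 / fact j * dir_deriv j f x0 \<eta>)\<bar>
        \<le> vnorm (\<eta> - x0) ^ k"
      using \<Omega> by (auto simp: WLUD_radius_def)
    also have "\<dots> \<le> \<sigma> ^ k" using r by (intro power_mono) (auto simp: vnorm_nonneg)
    also have "\<dots> < e" by (rule elim(1))
    finally show ?case by (simp only: One_nat_def sum.atLeast1_atMost_eq)
  qed
qed

theorem theorem9: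
  fixes \<iota> :: "real \<Rightarrow> 'a::{linordered_field, linorder_topology}"
    and \<phi> :: "'a set \<Rightarrow> real"
    and A :: "('a ^ 'n) set"
    and x0 :: "'a ^ 'n"
    and f :: "'a ^ 'n \<Rightarrow> 'a"
    and \<delta> :: "nat \<Rightarrow> 'a"
  assumes "nonarch_field \<iota> \<phi>"
    and "vopen A"
    and "x0 \<in> A"
    and "WLUD_infinity A f x0"
    and "\<And>k. k \<ge> 1 \<Longrightarrow> \<exists>\<Omega>. WLUD_nbhd k A f x0 \<Omega> \<and> WLUD_radius k f x0 \<Omega> 1 (\<delta> k)"
    and "limsup (\<lambda>j. MAX ls\<in>{ls :: 'n list. length ls = j}.
           - hahn_val \<phi> (partials ls f x0) / ereal (real j)) < \<infinity>"
    and "limsup (\<lambda>k. hahn_val \<phi> (\<delta> k)) < \<infinity>"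
  shows "\<exists>U. vopen U \<and> x0 \<in> U \<and> U \<subseteq> A \<and>
    (\<forall>\<eta>\<in>U. summable (\<lambda>j. 1 / fact (Suc j) * dir_deriv (Suc j) f x0 \<eta>) \<and>
      f \<eta> = f x0 + (\<Sum>j. 1 / fact (Suc j) * dir_deriv (Suc j) f x0 \<eta>))"
proof -
  interpret nonarch_field \<iota> \<phi> by fact
  note wlud = assms(5)
  have "0 < \<delta> k" if "1 \<le> k" for k using wlud[OF that] by (auto simp: WLUD_radius_def)
  then obtain \<sigma> where \<sigma>: "0 < \<sigma>" "0 < lam \<sigma>" "\<forall>\<^sub>F k in sequentially. \<sigma> < \<delta> k"
    using radii_bounded_below assms(7) by blast
  obtain U where U: "vopen U" "x0 \<in> U" "U \<subseteq> vball x0 \<sigma>"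
    using ex_cube_subset_vball[OF \<sigma>(1)] by blast
  have "U \<subseteq> A"
  proof -
    have "\<forall>\<^sub>F k in sequentially. \<sigma> < \<delta> k \<and> 1 \<le> k"
      using \<sigma>(3) eventually_ge_at_top[of 1] by (rule eventually_conj)
    then obtain k where k: "\<sigma> < \<delta> k" "1 \<le> k"
      using eventually_happens trivial_limit_sequentially by blast
    have "vball x0 \<sigma> \<subseteq> vball x0 (\<delta> k)" using k(1) by (auto simp: vball_def)
    moreover have "vball x0 (\<delta> k) \<subseteq> A"
      using wlud[OF k(2)] by (auto simp: WLUD_radius_def WLUD_nbhd_def)
    ultimately show ?thesis using U(3) by blast
  qed
  moreover have "(\<lambda>j. 1 / fact (Suc j) * dir_deriv (Suc j) f x0 \<eta>) sums (f \<eta> - f x0)"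
    if "\<eta> \<in> U" for \<eta>
    using that U(3) wlud by (intro taylor_series_sums[OF _ \<sigma>]) blast+
  ultimately show ?thesis using U(1,2) by (auto simp: sums_iff)
qed

end
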